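(* Let $\Phi=(A;E_0,\ldots,E_d;A^*;E^*_0,\ldots,E^*_d)$ be a Leonard system in $\mathcal A$ and let $V$ be the irreducible left $\mathcal A$-module. Let $g,h$ be adjacent elements of $S_4$ and consider the corresponding bases $\lbrack g\rbrack,\lbrack h\rbrack$ for $V$. Then: (i) if $g,h$ are $1$-adjacent, the transition matrix from $\lbrack g\rbrack$ to $\lbrack h\rbrack$ is diagonal; (ii) if $g,h$ are $2$-adjacent, the transition matrix from $\lbrack g\rbrack$ to $\lbrack h\rbrack$ is lower triangular; (iii) if $g,h$ are $3$-adjacent, then $\lbrack g\rbrack$ is the inversion of $\lbrack h\rbrack$.
   Context: Let $\mathbb K$ be an arbitrary field and $d\ge 0$ an integer. $\mathrm{Mat}_{d+1}(\mathbb K)$ is the $\mathbb K$-algebra of $(d+1)\times(d+1)$ matrices over $\mathbb K$, rows and columns indexed by $0,1,\ldots,d$; $\mathcal A$ is a $\mathbb K$-algebra isomorphic to it, with identity $I$. An element of $\mathcal A$ is multiplicity-free if it has $d+1$ distinct eigenvalues (roots of its minimal polynomial), all in $\mathbb K$. If $X\in\mathcal A$ is multiplicity-free with eigenvalues $\xi_0,\ldots,\xi_d$, the primitive idempotent of $X$ associated with $\xi_i$ is $\prod_{j\ne i}(X-\xi_jI)/(\xi_i-\xi_j)$. A Leonard system in $\mathcal A$ is a sequence $\Phi=(A;E_0,\ldots,E_d;A^*;E^*_0,\ldots,E^*_d)$ such that: (i) $A,A^*\in\mathcal A$ are both multiplicity-free; (ii) $E_0,\ldots,E_d$ is an ordering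 of the primitive idempotents of $A$; (iii) $E^*_0,\ldots,E^*_d$ is an ordering of the primitive idempotents of $A^*$; (iv) $E_iA^*E_j$ is $0$ if $|i-j|>1$ and nonzero if $|i-j|=1$; (v) $E^*_iAE^*_j$ is $0$ if $|i-j|>1$ and nonzero if $|i-j|=1$ ($0\le i,j\le d$). ($A^*$ is just a name, not a conjugate-transpose.) $\theta_i$ (resp. $\theta^*_i$) denotes the eigenvalue of $A$ (resp. $A^*$) associated with $E_i$ (resp. $E^*_i$). The irreducible left $\mathcal A$-module $V$ has dimension $d+1$. $S_4$ is identified with the set of linear orderings $wxyz$ of the four symbols $0,d,0^*,d^*$. The element $wxyz$ is $1$-adjacent to $xwyz$ only, $2$-adjacent to $wyxz$ only, and $3$-adjacent to $wxzy$ only; two elements are adjacent if they are $i$-adjacent for some $i\in\{1,2,3\}$. The 24 bases. Fix nonzero vectors $\eta_0\in E_0V$, $\eta_d\in E_dV$, $\eta^*_0\in E^*_0V$, $\eta^*_d\in E^*_dV$. For $0\le i\le d$ put $\tau_i=\prod_{h=0}^{i-1}(A-\theta_hI)$, $\sigma_i=\prod_{h=d-i+1}^{d}(A-\theta_hI)$, $\tau^*_i=\prod_{h=0}^{i-1}(A^*-\theta^*_hI)$, $\sigma^*_i=\prod_{h=d-i+1}^{d}(A^*-\theta^*_hI)$ (empty products are $I$). For $g\in S_4$, $\lbrack g\rbrack$ is the ordered basis $v_0,\ldots,v_d$ of $V$ with $v_i$ as follows: $d^*00^*d$: $\tau_i\eta^*_0$; $0d^*0^*d$: $\sigma^*_{d-i}\eta_d$;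 $d^*0d0^*$: $\tau_{d-i}\eta^*_0$; $0d^*d0^*$: $\sigma^*_i\eta_d$; $d0^*0d^*$: $\tau^*_i\eta_0$; $0^*d0d^*$: $\sigma_{d-i}\eta^*_d$; $d0^*d^*0$: $\tau^*_{d-i}\eta_0$; $0^*dd^*0$: $\sigma_i\eta^*_d$; $dd^*00^*$: $\sigma^*_i\eta_0$; $d^*d00^*$: $\sigma_{d-i}\eta^*_0$; $dd^*0^*0$: $\sigma^*_{d-i}\eta_0$; $d^*d0^*0$: $\sigma_i\eta^*_0$; $00^*dd^*$: $\tau^*_i\eta_d$; $0^*0dd^*$: $\tau_{d-i}\eta^*_d$; $00^*d^*d$: $\tau^*_{d-i}\eta_d$; $0^*0d^*d$: $\tau_i\eta^*_d$; $d^*0^*0d$: $E_i\eta^*_0$; $0^*d^*0d$: $E_i\eta^*_d$; $d^*0^*d0$: $E_{d-i}\eta^*_0$; $0^*d^*d0$: $E_{d-i}\eta^*_d$; $d00^*d^*$: $E^*_i\eta_0$; $0d0^*d^*$: $E^*_i\eta_d$; $d0d^*0^*$: $E^*_{d-i}\eta_0$; $0dd^*0^*$: $E^*_{d-i}\eta_d$. (It is known that each of these sequences is a basis for $V$.) The transition matrix from a basis $u_0,\ldots,u_d$ to a basis $v_0,\ldots,v_d$ is the matrix $T\in\mathrm{Mat}_{d+1}(\mathbb K)$ with $v_j=\sum_{i=0}^dT_{ij}u_i$ for $0\le j\le d$. The inversion of the basis $v_0,v_1,\ldots,v_d$ is the basis $v_d,v_{d-1},\ldots,v_0$. *)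

theory Defs
  imports
    "HOL-Computational_Algebra.Polynomial"
    "Jordan_Normal_Form.Matrix"
begin

section \<open>Algebras and modules\<close>

locale field_algebra = vector_space scale
  for scale :: "'k::field \<Rightarrow> 'a::ring_1 \<Rightarrow> 'a" +
  assumes scale_mult_left: "scale c x * y = scale c (x * y)"
    and scale_mult_right: "x * scale c y = scale c (x * y)"

locale full_matrix_algebra = field_algebra scale
  for scale :: "'k::field \<Rightarrow> 'a::ring_1 \<Rightarrow> 'a" and d :: nat +
  assumes iso_mat: "\<exists>\<phi> :: 'a \<Rightarrow> 'k mat.
      bij_betw \<phi> UNIV (carrier_mat (d + 1) (d + 1)) \<and>
      (\<forall>x y. \<phi> (x + y) = \<phi> x + \<phi> y) \<and>
      (\<forall>x y. \<phi> (x * y) = \<phi> x * \<phi> y) \<and>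
      \<phi> 1 = 1\<^sub>m (d + 1) \<and>
      (\<forall>c x. \<phi> (scale c x) = c \<cdot>\<^sub>m \<phi> x)"

text \<open>The locale \<open>module\<close> of the library requires a commutative ring of scalars, so left modules
  over the ring \<open>'a\<close> are introduced here.\<close>

locale left_module =
  fixes act :: "'a::ring_1 \<Rightarrow> 'v::ab_group_add \<Rightarrow> 'v"
  assumes act_add_left: "act (a + b) v = act a v + act b v"
    and act_add_right: "act a (v + w) = act a v + act a w"
    and act_mult: "act (a * b) v = act a (act b v)"
    and act_one: "act 1 v = v"

definition is_submodule :: "('a::ring_1 \<Rightarrow> 'v::ab_group_add \<Rightarrow> 'v) \<Rightarrow> 'v set \<Rightarrow> bool" where
  "is_submodule act W \<longleftrightarrow>
     0 \<in> W \<and> (\<forall>v\<in>W. \<forall>w\<in>W. v + w \<in> W) \<and> (\<forall>a. \<forall>v\<in>W. act a v \<in> W)"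

locale irreducible_left_module = left_module act
  for act :: "'a::ring_1 \<Rightarrow> 'v::ab_group_add \<Rightarrow> 'v" +
  assumes nonzero: "\<exists>v::'v. v \<noteq> 0"
    and irreducible: "is_submodule act W \<Longrightarrow> W = {0} \<or> W = UNIV"


section \<open>Multiplicity-free elements and primitive idempotents\<close>

definition poly_at :: "('k::field \<Rightarrow> 'a::ring_1 \<Rightarrow> 'a) \<Rightarrow> 'k poly \<Rightarrow> 'a \<Rightarrow> 'a" where
  "poly_at scale p X = (\<Sum>i\<le>degree p. scale (coeff p i) (X ^ i))"

definition min_poly :: "('k::field \<Rightarrow> 'a::ring_1 \<Rightarrow> 'a) \<Rightarrow> 'a \<Rightarrow> 'k poly" where
  "min_poly scale X =
     (THE p. lead_coeff p = 1 \<and> poly_at scale p X = 0 \<and>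
        (\<forall>q. q \<noteq> 0 \<and> poly_at scale q X = 0 \<longrightarrow> degree p \<le> degree q))"

definition eigenvalues :: "('k::field \<Rightarrow> 'a::ring_1 \<Rightarrow> 'a) \<Rightarrow> 'a \<Rightarrow> 'k set" where
  "eigenvalues scale X = {\<xi>. poly (min_poly scale X) \<xi> = 0}"

text \<open>The first conjunct says that every root of the minimal polynomial, in any extension field,
  lies in the ground field.\<close>

definition multiplicity_free ::
  "('k::field \<Rightarrow> 'a::ring_1 \<Rightarrow> 'a) \<Rightarrow> nat \<Rightarrow> 'a \<Rightarrow> bool" where
  "multiplicity_free scale d X \<longleftrightarrow>
     (\<exists>as. min_poly scale X = (\<Prod>a\<leftarrow>as. [:- a, 1:])) \<and>
     card (eigenvalues scale X) = d + 1"

definition prim_idem ::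
  "('k::field \<Rightarrow> 'a::ring_1 \<Rightarrow> 'a) \<Rightarrow> nat \<Rightarrow> 'a \<Rightarrow> (nat \<Rightarrow> 'k) \<Rightarrow> nat \<Rightarrow> 'a" where
  "prim_idem scale d X \<xi> i =
     (\<Prod>j \<leftarrow> filter (\<lambda>j. j \<noteq> i) [0..<d + 1]. scale (1 / (\<xi> i - \<xi> j)) (X - scale (\<xi> j) 1))"

text \<open>\<open>prim_idem_ordering scale d X \<xi> E\<close>: the sequence \<open>E 0, \<dots>, E d\<close> is an ordering of the primitive
  idempotents of \<open>X\<close>, and \<open>\<xi> i\<close> is the eigenvalue of \<open>X\<close> associated with \<open>E i\<close>. Only the values at
  \<open>i \<le> d\<close> matter.\<close>

definition prim_idem_ordering ::
  "('k::field \<Rightarrow> 'a::ring_1 \<Rightarrow> 'a) \<Rightarrow> nat \<Rightarrow> 'a \<Rightarrow> (nat \<Rightarrow> 'k) \<Rightarrow> (nat \<Rightarrow> 'a) \<Rightarrow> bool" where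
  "prim_idem_ordering scale d X \<xi> E \<longleftrightarrow>
     bij_betw \<xi> {0..d} (eigenvalues scale X) \<and> (\<forall>i\<le>d. E i = prim_idem scale d X \<xi> i)"


section \<open>Leonard systems\<close>

definition leonard_system ::
  "('k::field \<Rightarrow> 'a::ring_1 \<Rightarrow> 'a) \<Rightarrow> nat \<Rightarrow> 'a \<Rightarrow> (nat \<Rightarrow> 'a) \<Rightarrow> 'a \<Rightarrow> (nat \<Rightarrow> 'a) \<Rightarrow> bool" where
  "leonard_system scale d A E As Es \<longleftrightarrow>
     multiplicity_free scale d A \<and> multiplicity_free scale d As \<and>
     (\<exists>\<theta>. prim_idem_ordering scale d A \<theta> E) \<and>
     (\<exists>\<theta>s. prim_idem_ordering scale d As \<theta>s Es) \<and>
     (\<forall>i\<le>d. \<forall>j\<le>d.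
        (\<bar>int i - int j\<bar> > 1 \<longrightarrow> E i * As * E j = 0) \<and>
        (\<bar>int i - int j\<bar> = 1 \<longrightarrow> E i * As * E j \<noteq> 0)) \<and>
     (\<forall>i\<le>d. \<forall>j\<le>d.
        (\<bar>int i - int j\<bar> > 1 \<longrightarrow> Es i * A * Es j = 0) \<and>
        (\<bar>int i - int j\<bar> = 1 \<longrightarrow> Es i * A * Es j \<noteq> 0))"


section \<open>The 24 bases\<close>

definition tau :: "('k::field \<Rightarrow> 'a::ring_1 \<Rightarrow> 'a) \<Rightarrow> 'a \<Rightarrow> (nat \<Rightarrow> 'k) \<Rightarrow> nat \<Rightarrow> 'a" where
  "tau scale X \<xi> i = (\<Prod>h \<leftarrow> [0..<i]. X - scale (\<xi> h) 1)"

definition sigma :: "('k::field \<Rightarrow> 'a::ring_1 \<Rightarrow> 'a) \<Rightarrow> nat \<Rightarrow> 'a \<Rightarrow> (nat \<Rightarrow> 'k) \<Rightarrow> nat \<Rightarrow> 'a" where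
  "sigma scale d X \<xi> i = (\<Prod>h \<leftarrow> [d - i + 1..<d + 1]. X - scale (\<xi> h) 1)"

text \<open>\<open>S0\<close>, \<open>Sd\<close>, \<open>S0'\<close>, \<open>Sd'\<close> are the formal symbols $0$, $d$, $0^*$, $d^*$; they are distinct
  also when $d = 0$.\<close>

datatype symb = S0 | Sd | S0' | Sd'

definition S4 :: "symb list set" where
  "S4 = {g. length g = 4 \<and> distinct g}"

definition adjacent1 :: "symb list \<Rightarrow> symb list \<Rightarrow> bool" where
  "adjacent1 g h \<longleftrightarrow> g \<in> S4 \<and> (\<exists>w x y z. g = [w, x, y, z] \<and> h = [x, w, y, z])"

definition adjacent2 :: "symb list \<Rightarrow> symb list \<Rightarrow> bool" where
  "adjacent2 g h \<longleftrightarrow> g \<in> S4 \<and> (\<exists>w x y z. g = [w, x, y, z] \<and> h = [w, y, x, z])"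

definition adjacent3 :: "symb list \<Rightarrow> symb list \<Rightarrow> bool" where
  "adjacent3 g h \<longleftrightarrow> g \<in> S4 \<and> (\<exists>w x y z. g = [w, x, y, z] \<and> h = [w, x, z, y])"

definition adjacent :: "symb list \<Rightarrow> symb list \<Rightarrow> bool" where
  "adjacent g h \<longleftrightarrow> adjacent1 g h \<or> adjacent2 g h \<or> adjacent3 g h"

text \<open>\<open>basis_vec \<dots> g i\<close> is the \<open>i\<close>-th vector of the basis $[g]$, for \<open>g \<in> S4\<close> and \<open>i \<le> d\<close>.
  The arguments \<open>\<theta>\<close>, \<open>\<theta>s\<close> are the eigenvalue sequences of \<open>A\<close>, \<open>As\<close>, and \<open>\<eta>0\<close>, \<open>\<eta>d\<close>, \<open>\<eta>0s\<close>, \<open>\<eta>ds\<close>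
  are the chosen vectors in $E_0V$, $E_dV$, $E^*_0V$, $E^*_dV$.\<close>

definition basis_vec ::
  "('k::field \<Rightarrow> 'a::ring_1 \<Rightarrow> 'a) \<Rightarrow> ('a \<Rightarrow> 'v::ab_group_add \<Rightarrow> 'v) \<Rightarrow> nat \<Rightarrow>
   'a \<Rightarrow> (nat \<Rightarrow> 'a) \<Rightarrow> (nat \<Rightarrow> 'k) \<Rightarrow> 'a \<Rightarrow> (nat \<Rightarrow> 'a) \<Rightarrow> (nat \<Rightarrow> 'k) \<Rightarrow>
   'v \<Rightarrow> 'v \<Rightarrow> 'v \<Rightarrow> 'v \<Rightarrow> symb list \<Rightarrow> nat \<Rightarrow> 'v" where
  "basis_vec scale act d A E \<theta> As Es \<theta>s \<eta>0 \<eta>d \<eta>0s \<eta>ds g i =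
    (let \<tau> = tau scale A \<theta>; \<sigma> = sigma scale d A \<theta>;
         \<tau>s = tau scale As \<theta>s; \<sigma>s = sigma scale d As \<theta>s
     in the (map_of
       [([Sd', S0, S0', Sd], act (\<tau> i) \<eta>0s),
        ([S0, Sd', S0', Sd], act (\<sigma>s (d - i)) \<eta>d),
        ([Sd', S0, Sd, S0'], act (\<tau> (d - i)) \<eta>0s),
        ([S0, Sd', Sd, S0'], act (\<sigma>s i) \<eta>d),
        ([Sd, S0', S0, Sd'], act (\<tau>s i) \<eta>0),
        ([S0', Sd, S0, Sd'], act (\<sigma> (d - i)) \<eta>ds),
        ([Sd, S0', Sd', S0], act (\<tau>s (d - i)) \<eta>0),
        ([S0', Sd, Sd', S0], act (\<sigma> i) \<eta>ds),
        ([Sd, Sd', S0, S0'], act (\<sigma>s i) \<eta>0),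
        ([Sd', Sd, S0, S0'], act (\<sigma> (d - i)) \<eta>0s),
        ([Sd, Sd', S0', S0], act (\<sigma>s (d - i)) \<eta>0),
        ([Sd', Sd, S0', S0], act (\<sigma> i) \<eta>0s),
        ([S0, S0', Sd, Sd'], act (\<tau>s i) \<eta>d),
        ([S0', S0, Sd, Sd'], act (\<tau> (d - i)) \<eta>ds),
        ([S0, S0', Sd', Sd], act (\<tau>s (d - i)) \<eta>d),
        ([S0', S0, Sd', Sd], act (\<tau> i) \<eta>ds),
        ([Sd', S0', S0, Sd], act (E i) \<eta>0s),
        ([S0', Sd', S0, Sd], act (E i) \<eta>ds),
        ([Sd', S0', Sd, S0], act (E (d - i)) \<eta>0s),
        ([S0', Sd', Sd, S0], act (E (d - i)) \<eta>ds),
        ([Sd, S0, S0', Sd'], act (Es i) \<eta>0),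
        ([S0, Sd, S0', Sd'], act (Es i) \<eta>d),
        ([Sd, S0, Sd', S0'], act (Es (d - i)) \<eta>0),
        ([S0, Sd, Sd', S0'], act (Es (d - i)) \<eta>d)] g))"


section \<open>Transition matrices\<close>

text \<open>The ground field acts on a module over the algebra through multiples of the identity.\<close>

definition module_scale ::
  "('k::field \<Rightarrow> 'a::ring_1 \<Rightarrow> 'a) \<Rightarrow> ('a \<Rightarrow> 'v::ab_group_add \<Rightarrow> 'v) \<Rightarrow> 'k \<Rightarrow> 'v \<Rightarrow> 'v" where
  "module_scale scale act c v = act (scale c 1) v"

definition transition_matrix ::
  "('k::field \<Rightarrow> 'v::ab_group_add \<Rightarrow> 'v) \<Rightarrow> nat \<Rightarrow> (nat \<Rightarrow> 'v) \<Rightarrow> (nat \<Rightarrow> 'v) \<Rightarrow> 'k mat" where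
  "transition_matrix scaleV d u v =
     (THE T. T \<in> carrier_mat (d + 1) (d + 1) \<and>
        (\<forall>j\<le>d. v j = (\<Sum>i=0..d. scaleV (T $$ (i, j)) (u i))))"

definition lower_triangular :: "'k::zero mat \<Rightarrow> bool" where
  "lower_triangular T \<longleftrightarrow>
     (\<forall>i<dim_row T. \<forall>j<dim_col T. i < j \<longrightarrow> T $$ (i, j) = 0)"

definition inversion :: "nat \<Rightarrow> (nat \<Rightarrow> 'v) \<Rightarrow> nat \<Rightarrow> 'v" where
  "inversion d v i = v (d - i)"

end

theory Submission
  imports Defs
begin

text \<open>
  To each of the four symbols belongs a flag on the module: the partial sums of the eigenspaces of
  \<open>A\<close> or \<open>A*\<close>, taken in the given or the reversed order. The basis attached to \<open>wxyz\<close> is adapted to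
  the flag of \<open>y\<close> when read forwards and to the flag of \<open>z\<close> when read backwards. Hence a 1-adjacent
  pair shares both flags, and its transition matrix is upper and lower triangular, while a 2-adjacent
  pair shares the flag of \<open>z\<close>. By the symmetries of a Leonard system, adaptedness only has to be
  checked for \<open>\<tau>\<^sub>i \<eta>*\<^sub>0\<close> and \<open>E\<^sub>i \<eta>*\<^sub>0\<close>.
\<close>

section \<open>Modules over an algebra as vector spaces\<close>

locale algebra_module = field_algebra scale + left_module act
  for scale :: "'k::field \<Rightarrow> 'a::ring_1 \<Rightarrow> 'a" and act :: "'a \<Rightarrow> 'v::ab_group_add \<Rightarrow> 'v"
begin

abbreviation scaleV :: "'k \<Rightarrow> 'v \<Rightarrow> 'v" where
  "scaleV \<equiv> module_scale scale act"

lemma act_zero_right [simp]: "act a 0 = 0"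
  using act_add_right[of a 0 0] by simp

lemma act_zero_left [simp]: "act 0 v = 0"
  using act_add_left[of 0 0 v] by simp

lemma act_minus_right: "act a (- v) = - act a v"
  using act_add_right[of a v "- v"] by (simp add: eq_neg_iff_add_eq_0 add.commute)

lemma act_minus_left: "act (- a) v = - act a v"
  using act_add_left[of a "- a" v] by (simp add: eq_neg_iff_add_eq_0 add.commute)

lemma act_diff_right: "act a (v - w) = act a v - act a w"
  using act_add_right[of a v "- w"] by (simp add: act_minus_right)

lemma act_diff_left: "act (a - b) v = act a v - act b v"
  using act_add_left[of a "- b" v] by (simp add: act_minus_left)

lemma act_sum_right: "act a (\<Sum>i\<in>S. f i) = (\<Sum>i\<in>S. act a (f i))"
  by (induction S rule: infinite_finite_induct) (auto simp: act_add_right)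

lemma act_sum_left: "act (\<Sum>i\<in>S. f i) v = (\<Sum>i\<in>S. act (f i) v)"
  by (induction S rule: infinite_finite_induct) (auto simp: act_add_left)

lemma act_scale: "act (scale c a) v = scaleV c (act a v)"
  using scale_mult_left[of c 1 a] by (simp add: module_scale_def flip: act_mult)

text \<open>The element \<open>scale c 1\<close> is central in the algebra, so every
  \<open>act a\<close> is linear over the field.\<close>

lemma act_scaleV: "act a (scaleV c v) = scaleV c (act a v)"
  using scale_mult_left[of c 1 a] scale_mult_right[of a c 1]
  by (simp add: module_scale_def flip: act_mult)

sublocale V: vector_space scaleV
  by unfold_locales
    (simp_all add: module_scale_def act_add_left act_add_right scale_left_distrib act_one
      scale_mult_left flip: act_mult)

end

text \<open>The bound on independent sets settles an injective family. A family with a repetition,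
  whose image is a smaller set, has an obvious relation.\<close>

lemma (in vector_space) nontrivial_relation:
  assumes "finite T" "finite I" "card T < card I" "\<And>i. i \<in> I \<Longrightarrow> f i \<in> span T"
  obtains c where "(\<Sum>i\<in>I. scale (c i) (f i)) = 0" "\<exists>i\<in>I. c i \<noteq> 0"
proof (cases "inj_on f I")
  case True
  have "dependent (f ` I)"
  proof (rule ccontr)
    assume "\<not> dependent (f ` I)"
    then have "card (f ` I) \<le> card T"
      using independent_span_bound[of T "f ` I"] assms by auto
    with True assms show False by (simp add: card_image)
  qed
  then obtain u where u: "\<exists>v\<in>f ` I. u v \<noteq> 0" "(\<Sum>v\<in>f ` I. scale (u v) v) = 0"
    using dependent_finite[of "f ` I"] assms by auto
  show ?thesis
    by (rule that[of "u \<circ> f"]) (use u True in \<open>auto simp: sum.reindex\<close>)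
next
  case False
  then obtain i j where ij: "i \<in> I" "j \<in> I" "i \<noteq> j" "f i = f j"
    by (auto simp: inj_on_def)
  \<comment> \<open>These are the coefficients of the relation \<open>f i - f j = 0\<close>.\<close>
  let ?c = "\<lambda>k. if k = i then 1 else if k = j then - 1 else 0 :: 'a"
  have "(\<Sum>k\<in>I. scale (?c k) (f k)) = (\<Sum>k\<in>{i, j}. scale (?c k) (f k))"
    by (rule sum.mono_neutral_right) (use ij assms in auto)
  also have "\<dots> = 0" using ij by simp
  finally show ?thesis using ij by (intro that[of ?c] bexI[of _ i]) auto
qed

section \<open>The minimal polynomial\<close>

context field_algebra
begin

text \<open>Padding with zero coefficients lets polynomials of different degrees be compared over
  one common range.\<close>

lemma poly_at_eq_sum:
  assumes "degree p \<le> n"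
  shows "poly_at scale p X = (\<Sum>i\<le>n. scale (coeff p i) (X ^ i))"
  unfolding poly_at_def
  by (rule sum.mono_neutral_left) (use assms in \<open>auto simp: coeff_eq_0\<close>)

lemma poly_at_diff: "poly_at scale (p - q) X = poly_at scale p X - poly_at scale q X"
proof -
  let ?n = "max (degree p) (degree q)"
  have "poly_at scale (p - q) X = (\<Sum>i\<le>?n. scale (coeff (p - q) i) (X ^ i))"
    by (rule poly_at_eq_sum) (rule degree_diff_le_max)
  also have "\<dots> = poly_at scale p X - poly_at scale q X"
    by (simp add: poly_at_eq_sum[of p ?n] poly_at_eq_sum[of q ?n] scale_left_diff_distrib
      sum_subtractf)
  finally show ?thesis .
qed

lemma poly_at_smult: "poly_at scale (Polynomial.smult c p) X = scale c (poly_at scale p X)"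
  using poly_at_eq_sum[of "Polynomial.smult c p" "degree p" X]
  by (simp add: poly_at_def scale_sum_right degree_smult_le)

lemma poly_at_pCons: "poly_at scale (pCons a p) X = scale a 1 + X * poly_at scale p X"
proof -
  have "poly_at scale (pCons a p) X =
      (\<Sum>i\<le>Suc (degree p). scale (coeff (pCons a p) i) (X ^ i))"
    by (rule poly_at_eq_sum) (rule degree_pCons_le)
  also have "\<dots> = scale a 1 + (\<Sum>i\<le>degree p. scale (coeff p i) (X ^ Suc i))"
    by (subst sum.atMost_Suc_shift) simp
  finally show ?thesis
    by (simp add: poly_at_def sum_distrib_left scale_mult_right)
qed

lemma poly_at_linear_mult:
  "poly_at scale ([:- \<xi>, 1:] * q) X = (X - scale \<xi> 1) * poly_at scale q X"
proof -
  have "[:- \<xi>, 1:] * q = pCons 0 q - Polynomial.smult \<xi> q" by simp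
  then show ?thesis
    by (simp only: poly_at_diff poly_at_pCons poly_at_smult)
      (simp add: left_diff_distrib scale_mult_left)
qed

text \<open>Properties of the definite description \<open>min_poly\<close> rest on this. Existence:
  normalise an annihilating polynomial of least degree. Uniqueness: two monic candidates of equal
  degree differ by an annihilating polynomial of smaller degree.\<close>

lemma min_poly_unique_ex:
  assumes "q \<noteq> 0" "poly_at scale q X = 0"
  shows "\<exists>!p. lead_coeff p = 1 \<and> poly_at scale p X = 0 \<and>
           (\<forall>q. q \<noteq> 0 \<and> poly_at scale q X = 0 \<longrightarrow> degree p \<le> degree q)"
proof -
  obtain p where p: "p \<noteq> 0" "poly_at scale p X = 0"
      "\<And>q. q \<noteq> 0 \<and> poly_at scale q X = 0 \<Longrightarrow> degree p \<le> degree q"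
    using ex_has_least_nat[of "\<lambda>q. q \<noteq> 0 \<and> poly_at scale q X = 0" q degree] assms by auto
  show ?thesis
  proof (rule ex1I)
    show "lead_coeff (Polynomial.smult (inverse (lead_coeff p)) p) = 1 \<and>
        poly_at scale (Polynomial.smult (inverse (lead_coeff p)) p) X = 0 \<and>
        (\<forall>q. q \<noteq> 0 \<and> poly_at scale q X = 0 \<longrightarrow>
          degree (Polynomial.smult (inverse (lead_coeff p)) p) \<le> degree q)"
      using p by (simp add: poly_at_smult)
  next
    fix r
    let ?p = "Polynomial.smult (inverse (lead_coeff p)) p"
    assume r: "lead_coeff r = 1 \<and> poly_at scale r X = 0 \<and>
        (\<forall>q. q \<noteq> 0 \<and> poly_at scale q X = 0 \<longrightarrow> degree r \<le> degree q)"
    then have "r \<noteq> 0" by auto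
    with r p have deg: "degree r = degree p" by (simp add: order_antisym)
    have ann: "poly_at scale (r - ?p) X = 0"
      using r p by (simp add: poly_at_diff poly_at_smult)
    have "degree (r - ?p) \<le> degree p"
      using deg by (intro degree_diff_le) auto
    \<comment> \<open>If \<open>r - ?p\<close> were nonzero, minimality would force its degree to be
      exactly \<open>degree p\<close>, where its coefficient vanishes.\<close>
    moreover have "coeff (r - ?p) (degree p) = 0"
      using r p deg by auto
    ultimately show "r = ?p"
      using ann p(3)[of "r - ?p"] by (metis eq_iff_diff_eq_0 le_antisym leading_coeff_0_iff)
  qed
qed

lemma min_poly_props:
  assumes "q \<noteq> 0" "poly_at scale q X = 0"
  shows "lead_coeff (min_poly scale X) = 1" "poly_at scale (min_poly scale X) X = 0"
    "\<And>r. r \<noteq> 0 \<Longrightarrow> poly_at scale r X = 0 \<Longrightarrow> degree (min_poly scale X) \<le> degree r"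
  using theI'[OF min_poly_unique_ex[OF assms]] unfolding min_poly_def by blast+

end

section \<open>Triangular families\<close>

context algebra_module
begin

text \<open>The last two clauses say that each \<open>E h\<close> has rank one.\<close>

definition eigen_decomp :: "nat \<Rightarrow> 'a \<Rightarrow> (nat \<Rightarrow> 'k) \<Rightarrow> (nat \<Rightarrow> 'a) \<Rightarrow> bool" where
  "eigen_decomp d X \<xi> E \<longleftrightarrow>
     inj_on \<xi> {0..d} \<and>
     (\<forall>x. (\<Sum>h=0..d. act (E h) x) = x) \<and>
     (\<forall>h\<le>d. \<forall>k\<le>d. \<forall>x. act (E h) (act (E k) x) = (if h = k then act (E h) x else 0)) \<and>
     (\<forall>h\<le>d. \<forall>x. act (E h) (act X x) = scaleV (\<xi> h) (act (E h) x)) \<and>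
     (\<forall>h\<le>d. \<forall>x y. act (E h) y \<noteq> 0 \<longrightarrow> (\<exists>c. act (E h) x = scaleV c (act (E h) y))) \<and>
     (\<forall>h\<le>d. \<exists>x. act (E h) x \<noteq> 0)"

text \<open>The tridiagonality conditions of a Leonard system, read on vectors: a nonzero product
  becomes a vector that it does not kill.\<close>

definition tridiagonal :: "nat \<Rightarrow> (nat \<Rightarrow> 'a) \<Rightarrow> 'a \<Rightarrow> bool" where
  "tridiagonal d F X \<longleftrightarrow>
     (\<forall>i\<le>d. \<forall>j\<le>d.
       (\<bar>int i - int j\<bar> > 1 \<longrightarrow> (\<forall>x. act (F i) (act X (act (F j) x)) = 0)) \<and>
       (\<bar>int i - int j\<bar> = 1 \<longrightarrow> (\<exists>x. act (F i) (act X (act (F j) x)) \<noteq> 0)))"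

text \<open>If \<open>e\<close> comes from an eigenspace decomposition, this says that \<open>u 0, \<dots>, u i\<close> is a basis of
  the \<open>i\<close>-th component of the flag of partial sums of eigenspaces.\<close>

definition triangular :: "nat \<Rightarrow> (nat \<Rightarrow> 'a) \<Rightarrow> (nat \<Rightarrow> 'v) \<Rightarrow> bool" where
  "triangular d e u \<longleftrightarrow>
     (\<forall>i\<le>d. act (e i) (u i) \<noteq> 0 \<and> (\<forall>h\<le>d. i < h \<longrightarrow> act (e h) (u i) = 0))"

section \<open>Reversal of the orderings\<close>

lemma sum_reverse: "(\<Sum>h=0..d. f (d - h)) = (\<Sum>h=0..(d::nat). f h)"
  by (rule sum.reindex_bij_witness[of _ "\<lambda>h. d - h" "\<lambda>h. d - h"]) auto

text \<open>Together with \<open>tridiagonal_reverse\<close> this is the symmetry that reduces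
  statements about the symbols with \<open>d\<close> to those with 0.\<close>

lemma eigen_decomp_reverse:
  assumes "eigen_decomp d X \<xi> E"
  shows "eigen_decomp d X (inversion d \<xi>) (inversion d E)"
  unfolding eigen_decomp_def inversion_def
proof (intro conjI allI impI)
  show "inj_on (\<lambda>i. \<xi> (d - i)) {0..d}"
  proof (rule inj_onI)
    fix i j assume "i \<in> {0..d}" "j \<in> {0..d}" "\<xi> (d - i) = \<xi> (d - j)"
    moreover from this have "d - i = d - j"
      using assms unfolding eigen_decomp_def by (intro inj_onD[of \<xi> "{0..d}"]) auto
    ultimately show "i = j" by auto
  qed
  show "(\<Sum>h=0..d. act (E (d - h)) x) = x" for x
    using assms sum_reverse[of "\<lambda>h. act (E h) x" d] by (simp add: eigen_decomp_def)
next
  fix h k x assume "h \<le> d" "k \<le> d"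
  then have "(d - h = d - k) = (h = k)" by auto
  then show "act (E (d - h)) (act (E (d - k)) x) = (if h = k then act (E (d - h)) x else 0)"
    using assms by (simp add: eigen_decomp_def)
qed (use assms in \<open>auto simp: eigen_decomp_def\<close>)

lemma tridiagonal_reverse:
  assumes "tridiagonal d F X"
  shows "tridiagonal d (inversion d F) X"
  unfolding tridiagonal_def inversion_def
proof (intro allI impI)
  fix i j assume "i \<le> d" "j \<le> d"
  then have "\<bar>int (d - i) - int (d - j)\<bar> = \<bar>int i - int j\<bar>"
    by (simp add: of_nat_diff)
  then show "(\<bar>int i - int j\<bar> > 1 \<longrightarrow> (\<forall>x. act (F (d - i)) (act X (act (F (d - j)) x)) = 0)) \<and>
      (\<bar>int i - int j\<bar> = 1 \<longrightarrow> (\<exists>x. act (F (d - i)) (act X (act (F (d - j)) x)) \<noteq> 0))"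
    using assms[unfolded tridiagonal_def, rule_format, of "d - i" "d - j"] by simp
qed

section \<open>Expansion in a triangular family\<close>

text \<open>Let \<open>k\<close> be the largest index from \<open>m\<close> on with a nonzero
  coefficient. Then \<open>e k\<close> kills \<open>u j\<close> for \<open>j < k\<close>, and the
  coefficients above \<open>k\<close> vanish, so \<open>e k\<close> applied to \<open>x\<close>
  leaves only the nonzero \<open>k\<close>-th term. The case \<open>m = 0\<close> is linear
  independence; larger \<open>m\<close> gives zero patterns of transition matrices.\<close>

lemma triangular_coeff_zero:
  assumes "triangular d e u" and x: "x = (\<Sum>i=0..d. scaleV (c i) (u i))"
    and zero: "\<And>h. m \<le> h \<Longrightarrow> h \<le> d \<Longrightarrow> act (e h) x = 0"
    and "m \<le> i" "i \<le> d"
  shows "c i = 0"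
proof (rule ccontr)
  assume "c i \<noteq> 0"
  define S where "S = {i. m \<le> i \<and> i \<le> d \<and> c i \<noteq> 0}"
  have "finite S" "i \<in> S" using \<open>c i \<noteq> 0\<close> assms by (auto simp: S_def)
  define k where "k = Max S"
  have k: "k \<in> S" using \<open>finite S\<close> \<open>i \<in> S\<close> Max_in unfolding k_def by blast
  have gt: "c j = 0" if "k < j" "j \<le> d" for j
    using that k Max_ge[OF \<open>finite S\<close>, of j] unfolding k_def S_def by fastforce
  have "act (e k) x = (\<Sum>j=0..d. scaleV (c j) (act (e k) (u j)))"
    by (simp add: x act_sum_right act_scaleV)
  also have "\<dots> = (\<Sum>j\<in>{k}. scaleV (c j) (act (e k) (u j)))"
  proof (rule sum.mono_neutral_right)
    show "\<forall>j\<in>{0..d} - {k}. scaleV (c j) (act (e k) (u j)) = 0"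
    proof
      fix j assume j: "j \<in> {0..d} - {k}"
      show "scaleV (c j) (act (e k) (u j)) = 0"
        using j k gt[of j] assms(1) by (cases "j < k") (auto simp: triangular_def S_def)
    qed
  qed (use k in \<open>auto simp: S_def\<close>)
  finally have "scaleV (c k) (act (e k) (u k)) = 0"
    using zero[of k] k by (simp add: S_def)
  with k assms(1) show False by (auto simp: S_def triangular_def)
qed

text \<open>Elimination from the top: a multiple of \<open>u m\<close> removes the highest component
  of \<open>x\<close>, and induction handles the rest.\<close>

lemma triangular_spans:
  assumes "eigen_decomp d X \<xi> e" "triangular d e u"
  obtains c where "x = (\<Sum>i=0..d. scaleV (c i) (u i))"
proof -
  \<comment> \<open>At \<open>m = Suc d\<close> the vanishing condition is empty, so the claim
    covers every \<open>x\<close>.\<close>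
  have *: "\<exists>c. x = (\<Sum>i<m. scaleV (c i) (u i))"
    if "m \<le> Suc d" "\<forall>h\<le>d. m \<le> h \<longrightarrow> act (e h) x = 0" for m x
    using that
  proof (induction m arbitrary: x)
    case 0
    then have "(\<Sum>h=0..d. act (e h) x) = 0" by (intro sum.neutral) auto
    then show ?case using assms(1) by (auto simp: eigen_decomp_def)
  next
    case (Suc m)
    \<comment> \<open>The coefficient exists because \<open>e m\<close> has rank one and does not
      kill \<open>u m\<close>.\<close>
    obtain b where b: "act (e m) x = scaleV b (act (e m) (u m))"
      using assms Suc.prems unfolding eigen_decomp_def triangular_def by (metis Suc_le_mono)
    have "act (e h) (x - scaleV b (u m)) = 0" if "h \<le> d" "m \<le> h" for h
      using that b Suc.prems assms(2)
      by (cases "h = m") (auto simp: act_diff_right act_scaleV triangular_def)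
    then obtain c where "x - scaleV b (u m) = (\<Sum>i<m. scaleV (c i) (u i))"
      using Suc.IH[of "x - scaleV b (u m)"] Suc.prems by auto
    then have "x = (\<Sum>i<Suc m. scaleV ((c(m := b)) i) (u i))"
      by (simp add: algebra_simps)
    then show ?case by blast
  qed
  show ?thesis
    using *[of "Suc d" x] that by (auto simp: lessThan_Suc_atMost atLeast0AtMost)
qed

section \<open>Transition matrices between triangular families\<close>

text \<open>The definite description is justified by spanning, which gives existence, and by linear
  independence, which gives uniqueness.\<close>

lemma transition_matrix_props:
  assumes "eigen_decomp d X \<xi> e" "triangular d e u"
  shows "transition_matrix scaleV d u v \<in> carrier_mat (d + 1) (d + 1)"
    and "\<And>j. j \<le> d \<Longrightarrow>
      v j = (\<Sum>i=0..d. scaleV (transition_matrix scaleV d u v $$ (i, j)) (u i))"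
proof -
  let ?P = "\<lambda>T. T \<in> carrier_mat (d + 1) (d + 1) \<and>
    (\<forall>j\<le>d. v j = (\<Sum>i=0..d. scaleV (T $$ (i, j)) (u i)))"
  have "\<exists>c. v j = (\<Sum>i=0..d. scaleV (c i) (u i))" for j
    using triangular_spans[OF assms] by metis
  then obtain c where c: "\<And>j. v j = (\<Sum>i=0..d. scaleV (c j i) (u i))" by metis
  have "\<exists>!T. ?P T"
  proof (rule ex1I)
    show "?P (mat (d + 1) (d + 1) (\<lambda>(i, j). c j i))" using c by auto
  next
    fix T assume T: "?P T"
    have "T $$ (i, j) = c j i" if "i \<le> d" "j \<le> d" for i j
    proof -
      \<comment> \<open>Subtracting two expansions of \<open>v j\<close> gives an expansion of
        0.\<close>
      have "0 = (\<Sum>i=0..d. scaleV (T $$ (i, j) - c j i) (u i))"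
        using T c[of j] that by (simp add: V.scale_left_diff_distrib sum_subtractf)
      from triangular_coeff_zero[OF assms(2) this, of 0 i] that show ?thesis by simp
    qed
    then show "T = mat (d + 1) (d + 1) (\<lambda>(i, j). c j i)"
      using T by (intro eq_matI) auto
  qed
  from theI'[OF this]
  show "transition_matrix scaleV d u v \<in> carrier_mat (d + 1) (d + 1)"
    and "\<And>j. j \<le> d \<Longrightarrow>
      v j = (\<Sum>i=0..d. scaleV (transition_matrix scaleV d u v $$ (i, j)) (u i))"
    unfolding transition_matrix_def by blast+
qed

text \<open>The vector \<open>v j\<close> has no component above \<open>j\<close>, so its expansion
  involves only \<open>u 0\<close> to \<open>u j\<close>.\<close>

lemma transition_matrix_upper:
  assumes "eigen_decomp d X \<xi> e" "triangular d e u" "triangular d e v"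
    and "j < i" "i \<le> d"
  shows "transition_matrix scaleV d u v $$ (i, j) = 0"
  by (rule triangular_coeff_zero[OF assms(2) transition_matrix_props(2)[OF assms(1,2)], of j "Suc j"])
    (use assms in \<open>auto simp: triangular_def\<close>)

text \<open>Reading both families backwards turns this into the upper triangular argument for the
  flag of \<open>f\<close>; \<open>e\<close> only serves to make the matrix well defined.\<close>

lemma transition_matrix_lower:
  assumes "eigen_decomp d X \<xi> e" "triangular d e u"
    and "triangular d f (inversion d u)" "triangular d f (inversion d v)"
    and "i < j" "j \<le> d"
  shows "transition_matrix scaleV d u v $$ (i, j) = 0"
proof -
  let ?T = "transition_matrix scaleV d u v"
  have "v j = (\<Sum>i=0..d. scaleV (?T $$ (d - i, j)) (inversion d u i))"
    using transition_matrix_props(2)[OF assms(1,2) \<open>j \<le> d\<close>, of v]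
      sum_reverse[of "\<lambda>i. scaleV (?T $$ (i, j)) (u i)" d]
    by (simp add: inversion_def)
  \<comment> \<open>In the reversed family \<open>v j\<close> stands at position
    \<open>d - j\<close>.\<close>
  moreover have "act (f h) (v j) = 0" if "Suc (d - j) \<le> h" "h \<le> d" for h
  proof -
    have "act (f h) (inversion d v (d - j)) = 0"
      using assms(4) that unfolding triangular_def by auto
    with \<open>j \<le> d\<close> show ?thesis by (simp add: inversion_def)
  qed
  ultimately have "?T $$ (d - (d - i), j) = 0"
    using assms(3,5,6) by (intro triangular_coeff_zero[where i = "d - i" and m = "Suc (d - j)"]) auto
  with assms(5,6) show ?thesis by simp
qed

section \<open>Split bases and eigenbases\<close>

lemma eigen_decomp_eqI:
  assumes "eigen_decomp d X \<xi> E" "\<And>h. h \<le> d \<Longrightarrow> act (E h) x = act (E h) y"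
  shows "x = y"
proof -
  have "(\<Sum>h=0..d. act (E h) x) = (\<Sum>h=0..d. act (E h) y)"
    using assms(2) by (intro sum.cong) auto
  with assms(1) show ?thesis by (simp add: eigen_decomp_def)
qed

lemma act_linear_factor: "act (X - scale c 1) x = act X x - scaleV c x"
  by (simp add: act_diff_left act_scale act_one)

text \<open>On the \<open>h\<close>-th eigenspace \<open>X\<close> is the scalar
  \<open>\<xi> h\<close>, so a polynomial in \<open>X\<close> acts by its value there. The roots
  \<open>\<zeta>\<close> are left free so that the reversed sequence can be used too.\<close>

lemma act_idem_tau:
  assumes "eigen_decomp d X \<xi> E" "h \<le> d"
  shows "act (E h) (act (tau scale X \<zeta> i) x) = scaleV (\<Prod>k<i. \<xi> h - \<zeta> k) (act (E h) x)"
proof (induction i arbitrary: x)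
  case 0
  then show ?case by (simp add: tau_def act_one)
next
  case (Suc i)
  have "tau scale X \<zeta> (Suc i) = tau scale X \<zeta> i * (X - scale (\<zeta> i) 1)"
    by (simp add: tau_def)
  then have "act (E h) (act (tau scale X \<zeta> (Suc i)) x) =
      scaleV (\<Prod>k<i. \<xi> h - \<zeta> k) (act (E h) (act X x - scaleV (\<zeta> i) x))"
    by (simp only: act_mult Suc.IH act_linear_factor)
  also have "act (E h) (act X x - scaleV (\<zeta> i) x) = scaleV (\<xi> h - \<zeta> i) (act (E h) x)"
    using assms by (simp add: act_diff_right act_scaleV eigen_decomp_def V.scale_left_diff_distrib)
  finally show ?case by simp
qed

text \<open>In \<open>tau\<close> the new factor appears on the right. It moves to the left because
  on each component both factors are scalars.\<close>

lemma act_tau_Suc: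
  assumes "eigen_decomp d X \<xi> E"
  shows "act (tau scale X \<zeta> (Suc i)) x = act (X - scale (\<zeta> i) 1) (act (tau scale X \<zeta> i) x)"
proof (rule eigen_decomp_eqI[OF assms])
  fix h assume h: "h \<le> d"
  then have "act (E h) (act X y) = scaleV (\<xi> h) (act (E h) y)" for y
    using assms by (simp add: eigen_decomp_def)
  then show "act (E h) (act (tau scale X \<zeta> (Suc i)) x) =
      act (E h) (act (X - scale (\<zeta> i) 1) (act (tau scale X \<zeta> i) x))"
    by (simp add: act_linear_factor act_diff_right act_scaleV act_idem_tau[OF assms h] algebra_simps)
qed

text \<open>The product \<open>sigma\<close> is \<open>tau\<close> for the eigenvalues in reversed
  order, up to the order of the factors; this carries the results on \<open>tau\<close> over to
  \<open>sigma\<close>.\<close>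

lemma act_sigma:
  assumes "eigen_decomp d X \<xi> E" "i \<le> d"
  shows "act (sigma scale d X \<xi> i) x = act (tau scale X (inversion d \<xi>) i) x"
  using assms(2)
proof (induction i)
  case 0
  then show ?case by (simp add: sigma_def tau_def)
next
  case (Suc i)
  \<comment> \<open>The index list of \<open>sigma\<close> grows at the front, so its new factor is
    already on the left.\<close>
  have "[d - Suc i + 1..<d + 1] = (d - i) # [d - i + 1..<d + 1]"
    using Suc.prems upt_conv_Cons[of "d - i" "d + 1"] by (simp add: Suc_diff_Suc)
  then have "sigma scale d X \<xi> (Suc i) = (X - scale (\<xi> (d - i)) 1) * sigma scale d X \<xi> i"
    by (simp add: sigma_def del: upt_Suc)
  with Suc show ?case
    by (simp add: act_mult act_tau_Suc[OF assms(1)] inversion_def)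
qed

section \<open>Adaptedness of split bases and eigenbases\<close>

text \<open>By tridiagonality \<open>X\<close> raises the \<open>F\<close>-index by at most one, and
  subtracting scalars creates no higher component. The top component survives each step because
  \<open>F (Suc i) X F i\<close> is nonzero and \<open>F i\<close> has rank one.\<close>

lemma triangular_tau:
  assumes E: "eigen_decomp d X \<xi> E" and F: "eigen_decomp d Y \<upsilon> F" and tri: "tridiagonal d F X"
    and \<eta>: "act (F 0) \<eta> = \<eta>" "\<eta> \<noteq> 0"
  shows "triangular d F (\<lambda>i. act (tau scale X \<zeta> i) \<eta>)"
proof -
  let ?v = "\<lambda>i. act (tau scale X \<zeta> i) \<eta>"
  have "act (F i) (?v i) \<noteq> 0 \<and> (\<forall>h\<le>d. i < h \<longrightarrow> act (F h) (?v i) = 0)" if "i \<le> d" for i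
    using that
  proof (induction i)
    case 0
    have "act (F h) (act (F 0) \<eta>) = 0" if "h \<le> d" "h > 0" for h
      using F that by (simp add: eigen_decomp_def)
    with \<eta> show ?case by (simp add: tau_def act_one)
  next
    case (Suc i)
    then have IH: "act (F i) (?v i) \<noteq> 0" "\<And>h. h \<le> d \<Longrightarrow> i < h \<Longrightarrow> act (F h) (?v i) = 0"
      by auto
    \<comment> \<open>Above index \<open>i\<close> only the \<open>i\<close>-th component of
      \<open>?v i\<close> contributes: higher components vanish by induction, and lower ones are
      more than one step away from \<open>h\<close>.\<close>
    have step: "act (F h) (?v (Suc i)) = act (F h) (act X (act (F i) (?v i)))"
      if h: "h \<le> d" "i < h" for h
    proof -
      have "act (F h) (?v (Suc i)) = act (F h) (act X (?v i))"
        using IH(2)[of h] h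
        by (simp add: act_tau_Suc[OF E] act_linear_factor act_diff_right act_scaleV)
      also have "\<dots> = act (F h) (act X (\<Sum>k=0..d. act (F k) (?v i)))"
        using F by (simp add: eigen_decomp_def)
      also have "\<dots> = (\<Sum>k=0..d. act (F h) (act X (act (F k) (?v i))))"
        by (simp add: act_sum_right)
      also have "\<dots> = (\<Sum>k\<in>{i}. act (F h) (act X (act (F k) (?v i))))"
      proof (rule sum.mono_neutral_right)
        show "\<forall>k\<in>{0..d} - {i}. act (F h) (act X (act (F k) (?v i))) = 0"
        proof
          fix k assume k: "k \<in> {0..d} - {i}"
          show "act (F h) (act X (act (F k) (?v i))) = 0"
          proof (cases "i < k")
            case True
            then show ?thesis using IH(2)[of k] k by simp
          next
            case False
            with k h have "\<bar>int h - int k\<bar> > 1" "k \<le> d" by auto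
            with tri h show ?thesis unfolding tridiagonal_def by blast
          qed
        qed
      qed (use Suc.prems in auto)
      finally show ?thesis by simp
    qed
    have "act (F h) (?v (Suc i)) = 0" if "h \<le> d" "Suc i < h" for h
    proof -
      have "\<bar>int h - int i\<bar> > 1" "i \<le> d" using that by auto
      with tri that step[of h] show ?thesis unfolding tridiagonal_def by auto
    qed
    moreover have "act (F (Suc i)) (?v (Suc i)) \<noteq> 0"
    proof
      assume zero: "act (F (Suc i)) (?v (Suc i)) = 0"
      have "\<bar>int (Suc i) - int i\<bar> = 1" by simp
      with tri Suc.prems obtain x where x: "act (F (Suc i)) (act X (act (F i) x)) \<noteq> 0"
        unfolding tridiagonal_def by (meson Suc_leD)
      \<comment> \<open>By rank one the vector witnessing nonvanishing may be replaced by a multiple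
        of \<open>act (F i) (?v i)\<close>.\<close>
      obtain c where "act (F i) x = scaleV c (act (F i) (?v i))"
        using F IH(1) Suc.prems unfolding eigen_decomp_def by (meson Suc_leD)
      with x zero step[of "Suc i"] Suc.prems show False by (simp add: act_scaleV)
    qed
    ultimately show ?case by blast
  qed
  then show ?thesis by (simp add: triangular_def)
qed

text \<open>The vectors \<open>tau i \<eta>\<close> span the module, so \<open>\<eta>\<close> generates it under \<open>X\<close> and has a component in
  every eigenspace of \<open>X\<close>.\<close>

lemma act_idem_nonzero:
  assumes E: "eigen_decomp d X \<xi> E" and F: "eigen_decomp d Y \<upsilon> F" and tri: "tridiagonal d F X"
    and \<eta>: "act (F 0) \<eta> = \<eta>" "\<eta> \<noteq> 0" and i: "i \<le> d"
  shows "act (E i) \<eta> \<noteq> 0"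
proof
  assume zero: "act (E i) \<eta> = 0"
  obtain x where x: "act (E i) x \<noteq> 0" using E i by (auto simp: eigen_decomp_def)
  obtain c where "x = (\<Sum>j=0..d. scaleV (c j) (act (tau scale X \<xi> j) \<eta>))"
    using triangular_spans[OF F triangular_tau[OF E F tri \<eta>]] .
  then have "act (E i) x = 0"
    by (simp add: act_sum_right act_scaleV act_idem_tau[OF E i] zero)
  with x show False ..
qed

text \<open>The \<open>h\<close>-th component of \<open>tau i\<close> applied to
  \<open>\<eta>\<close> is that of \<open>\<eta>\<close> times the product of
  \<open>\<xi> h - \<xi> k\<close> over \<open>k < i\<close>. This factor is zero for
  \<open>h < i\<close> and, the eigenvalues being distinct, nonzero for
  \<open>h = i\<close>.\<close>

lemma triangular_tau_reverse:
  assumes E: "eigen_decomp d X \<xi> E" and F: "eigen_decomp d Y \<upsilon> F" and tri: "tridiagonal d F X"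
    and \<eta>: "act (F 0) \<eta> = \<eta>" "\<eta> \<noteq> 0"
  shows "triangular d (inversion d E) (\<lambda>i. act (tau scale X \<xi> (d - i)) \<eta>)"
proof -
  have "act (E i) (act (tau scale X \<xi> i) \<eta>) \<noteq> 0" if "i \<le> d" for i
  proof -
    have "(\<Prod>k<i. \<xi> i - \<xi> k) \<noteq> 0"
    proof
      assume "(\<Prod>k<i. \<xi> i - \<xi> k) = 0"
      then obtain k where k: "k < i" "\<xi> i = \<xi> k" by auto
      have "inj_on \<xi> {0..d}" using E by (simp add: eigen_decomp_def)
      from inj_onD[OF this, of i k] k that show False by simp
    qed
    with that act_idem_nonzero[OF assms that] show ?thesis by (simp add: act_idem_tau[OF E])
  qed
  moreover have "act (E h) (act (tau scale X \<xi> i) \<eta>) = 0" if "i \<le> d" "h < i" for h i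
  proof -
    have "(\<Prod>k<i. \<xi> h - \<xi> k) = 0" using that by auto
    with that show ?thesis by (simp add: act_idem_tau[OF E])
  qed
  ultimately show ?thesis by (simp add: triangular_def inversion_def)
qed

text \<open>Each vector is a nonzero eigenvector with a single component, so the family is adapted
  to the flags of both orders.\<close>

lemma triangular_idem:
  assumes E: "eigen_decomp d X \<xi> E" and F: "eigen_decomp d Y \<upsilon> F" and tri: "tridiagonal d F X"
    and \<eta>: "act (F 0) \<eta> = \<eta>" "\<eta> \<noteq> 0"
  shows "triangular d E (\<lambda>i. act (E i) \<eta>)"
    and "triangular d (inversion d E) (\<lambda>i. act (E (d - i)) \<eta>)"
proof -
  have "act (E h) (act (E k) x) = (if h = k then act (E h) x else 0)"
    if "h \<le> d" "k \<le> d" for h k x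
    using E that by (simp add: eigen_decomp_def)
  with act_idem_nonzero[OF assms]
  show "triangular d E (\<lambda>i. act (E i) \<eta>)"
    and "triangular d (inversion d E) (\<lambda>i. act (E (d - i)) \<eta>)"
    by (auto simp: triangular_def inversion_def)
qed

lemma triangular_cong:
  assumes "\<And>i. i \<le> d \<Longrightarrow> e i = f i" "\<And>i. i \<le> d \<Longrightarrow> u i = v i"
  shows "triangular d e u \<longleftrightarrow> triangular d f v"
  using assms by (auto simp: triangular_def)

text \<open>Both claims are the results on \<open>tau\<close> for the reversed eigenvalues; in the
  second the two reversals of \<open>E\<close> cancel.\<close>

lemma triangular_sigma:
  assumes E: "eigen_decomp d X \<xi> E" and F: "eigen_decomp d Y \<upsilon> F" and tri: "tridiagonal d F X"
    and \<eta>: "act (F 0) \<eta> = \<eta>" "\<eta> \<noteq> 0"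
  shows "triangular d F (\<lambda>i. act (sigma scale d X \<xi> i) \<eta>)"
    and "triangular d E (\<lambda>i. act (sigma scale d X \<xi> (d - i)) \<eta>)"
proof -
  have "triangular d F (\<lambda>i. act (sigma scale d X \<xi> i) \<eta>) \<longleftrightarrow>
      triangular d F (\<lambda>i. act (tau scale X (inversion d \<xi>) i) \<eta>)"
    by (rule triangular_cong) (simp_all add: act_sigma[OF E])
  with triangular_tau[OF assms] show "triangular d F (\<lambda>i. act (sigma scale d X \<xi> i) \<eta>)" by simp
  have "triangular d E (\<lambda>i. act (sigma scale d X \<xi> (d - i)) \<eta>) \<longleftrightarrow>
      triangular d (inversion d (inversion d E))
        (\<lambda>i. act (tau scale X (inversion d \<xi>) (d - i)) \<eta>)"
    by (rule triangular_cong) (simp add: inversion_def, simp add: act_sigma[OF E])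
  with triangular_tau_reverse[OF eigen_decomp_reverse[OF E] F tri \<eta>]
  show "triangular d E (\<lambda>i. act (sigma scale d X \<xi> (d - i)) \<eta>)" by simp
qed

end

section \<open>Matrix algebras\<close>

locale matrix_module = full_matrix_algebra scale d + irreducible_left_module act
  for scale :: "'k::field \<Rightarrow> 'a::ring_1 \<Rightarrow> 'a" and d :: nat
    and act :: "'a \<Rightarrow> 'v::ab_group_add \<Rightarrow> 'v"
begin

sublocale algebra_module scale act ..

text \<open>Here \<open>e i j\<close> is the preimage of a matrix unit and \<open>m a j k\<close> is
  the entry of the matrix of \<open>a\<close>. Later arguments use the isomorphism only through
  these three properties.\<close>

lemma matrix_units:
  obtains e :: "nat \<Rightarrow> nat \<Rightarrow> 'a" and m :: "'a \<Rightarrow> nat \<Rightarrow> nat \<Rightarrow> 'k"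
  where "\<And>i j k l a. i \<le> d \<Longrightarrow> j \<le> d \<Longrightarrow> k \<le> d \<Longrightarrow> l \<le> d \<Longrightarrow>
      e i j * a * e k l = scale (m a j k) (e i l)"
    and "(\<Sum>i=0..d. e i i) = 1"
    and "\<And>i. i \<le> d \<Longrightarrow> m 1 i i = 1"
proof -
  obtain \<phi> :: "'a \<Rightarrow> 'k mat" where bij: "bij_betw \<phi> UNIV (carrier_mat (d + 1) (d + 1))"
    and add: "\<And>x y. \<phi> (x + y) = \<phi> x + \<phi> y" and mult: "\<And>x y. \<phi> (x * y) = \<phi> x * \<phi> y"
    and one: "\<phi> 1 = 1\<^sub>m (d + 1)" and smult: "\<And>c x. \<phi> (scale c x) = c \<cdot>\<^sub>m \<phi> x"
    using iso_mat by blast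
  have carrier [simp]: "\<phi> x \<in> carrier_mat (d + 1) (d + 1)" for x
    using bij by (auto simp: bij_betw_def)
  have dims [simp]: "dim_row (\<phi> x) = d + 1" "dim_col (\<phi> x) = d + 1" for x
    using carrier[of x] by auto
  have inj: "x = y" if "\<phi> x = \<phi> y" for x y
    using bij that by (auto simp: bij_betw_def inj_def)
  define U where "U i j = mat (d + 1) (d + 1) (\<lambda>(r, c). if r = i \<and> c = j then 1 else 0 :: 'k)" for i j
  define e where "e i j = inv_into UNIV \<phi> (U i j)" for i j
  have phi_e: "\<phi> (e i j) = U i j" for i j
    unfolding e_def by (rule f_inv_into_f) (use bij in \<open>auto simp: bij_betw_def U_def\<close>)
  have "e i j * a * e k l = scale (\<phi> a $$ (j, k)) (e i l)"
    if "i \<le> d" "j \<le> d" "k \<le> d" "l \<le> d" for i j k l a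
  proof (rule inj, rule eq_matI)
    fix r c
    assume "r < dim_row (\<phi> (scale (\<phi> a $$ (j, k)) (e i l)))"
      and "c < dim_col (\<phi> (scale (\<phi> a $$ (j, k)) (e i l)))"
    then have rc: "r < d + 1" "c < d + 1" by auto
    have left: "(U i j * \<phi> a) $$ (r, t) = (if r = i then \<phi> a $$ (j, t) else 0)"
      if "t < d + 1" for t
    proof -
      have "(U i j * \<phi> a) $$ (r, t) =
          (\<Sum>s\<in>{0..<d + 1}. (if r = i \<and> s = j then 1 else 0) * \<phi> a $$ (s, t))"
        using rc that by (simp add: U_def scalar_prod_def)
      also have "\<dots> = (\<Sum>s\<in>{0..<d + 1}. if s = j then (if r = i then \<phi> a $$ (j, t) else 0) else 0)"
        by (intro sum.cong) auto
      finally show ?thesis using \<open>j \<le> d\<close> by simp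
    qed
    have "\<phi> (e i j * a * e k l) $$ (r, c) = (U i j * \<phi> a * U k l) $$ (r, c)"
      by (simp add: mult phi_e)
    also have "\<dots> = (\<Sum>t\<in>{0..<d + 1}.
        (U i j * \<phi> a) $$ (r, t) * (if t = k \<and> c = l then 1 else 0))"
      using rc by (simp add: U_def scalar_prod_def)
    also have "\<dots> = (\<Sum>t\<in>{0..<d + 1}.
        if t = k then (if r = i \<and> c = l then \<phi> a $$ (j, k) else 0) else 0)"
      by (intro sum.cong) (auto simp: left simp del: index_mult_mat)
    also have "\<dots> = (if r = i \<and> c = l then \<phi> a $$ (j, k) else 0)"
      using \<open>k \<le> d\<close> by simp
    also have "\<dots> = \<phi> (scale (\<phi> a $$ (j, k)) (e i l)) $$ (r, c)"
      using rc by (simp add: smult phi_e U_def)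
    finally show "\<phi> (e i j * a * e k l) $$ (r, c) =
        \<phi> (scale (\<phi> a $$ (j, k)) (e i l)) $$ (r, c)" .
  qed auto
  moreover have "(\<Sum>i=0..d. e i i) = 1"
  proof (rule inj, rule eq_matI)
    fix r c assume "r < dim_row (\<phi> 1)" "c < dim_col (\<phi> 1)"
    then have rc: "r < d + 1" "c < d + 1" by auto
    \<comment> \<open>The matrix of 0 vanishes since it equals 0 times itself.\<close>
    have zero: "\<phi> 0 $$ (r, c) = 0"
      using arg_cong[OF smult[of 0 0], of "\<lambda>M. M $$ (r, c)"] rc by simp
    have "\<phi> (\<Sum>i\<in>S. e i i) $$ (r, c) = (\<Sum>i\<in>S. U i i $$ (r, c))" if "finite S" for S
      using that by induction (use rc in \<open>auto simp: zero add phi_e\<close>)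
    then have "\<phi> (\<Sum>i=0..d. e i i) $$ (r, c) = (\<Sum>i=0..d. U i i $$ (r, c))" by simp
    also have "\<dots> = (\<Sum>i=0..d. if i = r then (if r = c then 1 else 0) else 0)"
      using rc by (intro sum.cong) (auto simp: U_def)
    also have "\<dots> = \<phi> 1 $$ (r, c)" using rc by (simp add: one)
    finally show "\<phi> (\<Sum>i=0..d. e i i) $$ (r, c) = \<phi> 1 $$ (r, c)" .
  qed auto
  moreover have "\<phi> 1 $$ (i, i) = 1" if "i \<le> d" for i
    using that by (simp add: one)
  ultimately show ?thesis by (rule that)
qed

text \<open>The module is a copy of one column of the matrix algebra. Its column vectors
  \<open>b i\<close> span a nonzero submodule, hence everything; faithfulness holds because matrix
  entries can be read off from the action; an annihilating polynomial exists because the algebra has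
  finite dimension.\<close>

lemma faithful_spanned:
  obtains b where "V.span (b ` {0..d}) = UNIV"
    and "\<And>a. (\<And>x. act a x = 0) \<Longrightarrow> a = 0"
    and "\<And>X. \<exists>q. q \<noteq> 0 \<and> poly_at scale q X = 0"
proof -
  obtain e m where em: "\<And>i j k l a. i \<le> d \<Longrightarrow> j \<le> d \<Longrightarrow> k \<le> d \<Longrightarrow> l \<le> d \<Longrightarrow>
      e i j * a * e k l = scale (m a j k) (e i l)"
    and sum_e: "(\<Sum>i=0..d. e i i) = 1" and m1: "\<And>i. i \<le> d \<Longrightarrow> m 1 i i = 1"
    using matrix_units by blast
  have decomp: "a = (\<Sum>i=0..d. \<Sum>j=0..d. scale (m a i j) (e i j))" for a
  proof -
    have "a = (\<Sum>i=0..d. e i i) * a * (\<Sum>j=0..d. e j j)" by (simp add: sum_e)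
    also have "\<dots> = (\<Sum>i=0..d. \<Sum>j=0..d. e i i * a * e j j)"
      by (simp add: sum_distrib_left sum_distrib_right) (rule sum.swap)
    also have "\<dots> = (\<Sum>i=0..d. \<Sum>j=0..d. scale (m a i j) (e i j))"
      by (intro sum.cong) (auto simp: em)
    finally show ?thesis .
  qed
  obtain v0 :: 'v where "v0 \<noteq> 0" using nonzero by blast
  have "(\<Sum>i=0..d. act (e i i) v0) = v0"
    using sum_e by (simp add: act_one flip: act_sum_left)
  \<comment> \<open>The \<open>e i i\<close> sum to 1, so they cannot all kill
    \<open>v0\<close>.\<close>
  with \<open>v0 \<noteq> 0\<close> obtain k where k: "k \<le> d" "act (e k k) v0 \<noteq> 0"
    using sum.neutral[of "{0..d}" "\<lambda>i. act (e i i) v0"] by fastforce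
  define w where "w = act (e k k) v0"
  have "w \<noteq> 0" using k by (simp add: w_def)
  have e_kk: "act (e k k) w = w"
    using em[of k k k k 1] k m1[of k] by (simp add: w_def flip: act_mult)
  define b where "b i = act (e i k) w" for i
  have act_b: "act a (b j) = (\<Sum>i=0..d. scaleV (m a i j) (b i))" if "j \<le> d" for a j
  proof -
    have "a * e j k = (\<Sum>i=0..d. e i i) * (a * e j k)" by (simp add: sum_e)
    also have "\<dots> = (\<Sum>i=0..d. e i i * a * e j k)"
      by (simp add: sum_distrib_right mult.assoc)
    also have "\<dots> = (\<Sum>i=0..d. scale (m a i j) (e i k))"
      using that k by (intro sum.cong) (auto simp: em)
    finally show ?thesis
      by (simp add: b_def act_sum_left act_scale flip: act_mult)
  qed
  have closed: "act a x \<in> V.span (b ` {0..d})" if "x \<in> V.span (b ` {0..d})" for a x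
    using that
  proof (induction rule: V.span_induct_alt)
    case base
    show ?case by (simp add: V.span_zero)
  next
    case (step c x y)
    then obtain j where "x = b j" "j \<le> d" by auto
    then have "act a x \<in> V.span (b ` {0..d})"
      unfolding \<open>x = b j\<close> act_b[OF \<open>j \<le> d\<close>] by (intro V.span_sum V.span_scale V.span_base) auto
    with step show ?case
      by (simp add: act_add_right act_scaleV V.span_add V.span_scale)
  qed
  have "is_submodule act (V.span (b ` {0..d}))"
    unfolding is_submodule_def using closed by (auto intro: V.span_zero V.span_add)
  \<comment> \<open>The span is nonzero since \<open>w\<close> equals \<open>b k\<close>.\<close>
  moreover have "w \<in> V.span (b ` {0..d})"
    using k e_kk by (metis V.span_base atLeastAtMost_iff b_def image_eqI le0)
  ultimately have "V.span (b ` {0..d}) = UNIV"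
    using irreducible \<open>w \<noteq> 0\<close> by blast
  moreover have "a = 0" if a: "\<And>x. act a x = 0" for a
  proof -
    have "m a i j = 0" if "i \<le> d" "j \<le> d" for i j
    proof -
      \<comment> \<open>The product is \<open>m a i j\<close> times \<open>e k k\<close>, and
        \<open>e k k\<close> fixes \<open>w\<close>.\<close>
      have "act (e k i * a * e j k) w = scaleV (m a i j) w"
        using that k e_kk by (simp add: em act_scale)
      with a \<open>w \<noteq> 0\<close> show ?thesis by (simp add: act_mult)
    qed
    then have "(\<Sum>i=0..d. \<Sum>j=0..d. scale (m a i j) (e i j)) = 0"
      by (intro sum.neutral ballI) simp
    with decomp[of a] show ?thesis by simp
  qed
  moreover have "\<exists>q. q \<noteq> 0 \<and> poly_at scale q X = 0" for X
  proof -
    let ?T = "(\<lambda>(i, j). e i j) ` ({0..d} \<times> {0..d})"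
    have in_span: "a \<in> span ?T" for a
      by (subst decomp[of a], intro span_sum span_scale span_base) force
    \<comment> \<open>The powers from 0 to \<open>card ?T\<close> are one more than the generators
      in \<open>?T\<close>.\<close>
    obtain c where c: "(\<Sum>i\<le>card ?T. scale (c i) (X ^ i)) = 0" "\<exists>i\<le>card ?T. c i \<noteq> 0"
      by (rule nontrivial_relation[of ?T "{..card ?T}" "\<lambda>i. X ^ i"]) (use in_span in auto)
    let ?q = "\<Sum>i\<le>card ?T. monom (c i) i"
    have coeff: "coeff ?q i = (if i \<le> card ?T then c i else 0)" for i
      by (simp add: coeff_sum)
    have "degree ?q \<le> card ?T"
      by (rule degree_le) (simp add: coeff)
    then have "poly_at scale ?q X = (\<Sum>i\<le>card ?T. scale (coeff ?q i) (X ^ i))"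
      by (rule poly_at_eq_sum)
    also have "\<dots> = (\<Sum>i\<le>card ?T. scale (c i) (X ^ i))"
      by (intro sum.cong) (simp_all add: coeff)
    also have "\<dots> = 0" by (rule c)
    finally have "poly_at scale ?q X = 0" .
    moreover have "?q \<noteq> 0"
    proof
      assume zero: "?q = 0"
      obtain i where i: "i \<le> card ?T" "c i \<noteq> 0" using c(2) by blast
      from coeff[of i] have "c i = 0" unfolding zero using i(1) by simp
      with i(2) show False by simp
    qed
    ultimately show ?thesis by blast
  qed
  ultimately show ?thesis by (rule that)
qed

lemma act_faithful: "(\<And>x. act a x = 0) \<Longrightarrow> a = 0"
  using faithful_spanned by metis

section \<open>Eigenvectors and primitive idempotents\<close>

text \<open>Split off the root: the cofactor \<open>q\<close> has smaller degree than the minimal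
  polynomial, so \<open>q\<close> at \<open>X\<close> is nonzero. By faithfulness it has a nonzero
  value, which \<open>X - scale \<xi> 1\<close> kills.\<close>

lemma eigenvector_exists:
  assumes "\<xi> \<in> eigenvalues scale X"
  obtains x where "x \<noteq> 0" "act X x = scaleV \<xi> x"
proof -
  let ?p = "min_poly scale X"
  obtain q0 where q0: "q0 \<noteq> 0" "poly_at scale q0 X = 0" using faithful_spanned by metis
  note p = min_poly_props[OF q0]
  have "poly ?p \<xi> = 0" using assms by (simp add: eigenvalues_def)
  then obtain q where q: "?p = [:- \<xi>, 1:] * q"
    unfolding poly_eq_0_iff_dvd dvd_def by blast
  have "?p \<noteq> 0" using p(1) by auto
  then have "q \<noteq> 0" using q by auto
  then have "degree ?p = Suc (degree q)" unfolding q by (subst degree_mult_eq) auto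
  with p(3)[OF \<open>q \<noteq> 0\<close>] have "poly_at scale q X \<noteq> 0" by auto
  then obtain v where v: "act (poly_at scale q X) v \<noteq> 0" using act_faithful by blast
  have "(X - scale \<xi> 1) * poly_at scale q X = 0"
    using p(2) by (simp only: q poly_at_linear_mult)
  then have "act (X - scale \<xi> 1) (act (poly_at scale q X) v) = 0"
    by (simp flip: act_mult)
  with that[OF v] show ?thesis by (simp add: act_linear_factor)
qed

text \<open>The scalar is the Lagrange basis polynomial for the node \<open>\<xi> i\<close>,
  evaluated at \<open>c\<close>.\<close>

lemma act_prim_idem_eigenvector:
  assumes "act X x = scaleV c x"
  shows "act (prim_idem scale d X \<xi> i) x =
    scaleV (\<Prod>j\<leftarrow>filter (\<lambda>j. j \<noteq> i) [0..<d + 1]. (c - \<xi> j) / (\<xi> i - \<xi> j)) x"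
proof -
  have "act (\<Prod>j\<leftarrow>js. scale (1 / (\<xi> i - \<xi> j)) (X - scale (\<xi> j) 1)) x =
      scaleV (\<Prod>j\<leftarrow>js. (c - \<xi> j) / (\<xi> i - \<xi> j)) x" for js
    by (induction js)
      (simp_all add: act_one act_mult act_scaleV act_scale act_linear_factor assms mult.commute
        flip: V.scale_left_diff_distrib)
  then show ?thesis unfolding prim_idem_def .
qed

text \<open>Choose an eigenvector \<open>w i\<close> for each eigenvalue. Lagrange interpolation
  shows that \<open>E h\<close> fixes \<open>w h\<close> and kills the others, and the bound on the
  dimension makes the \<open>w i\<close> a basis. In its coordinates every clause is
  immediate.\<close>

lemma prim_idem_ordering_eigen_decomp:
  assumes "prim_idem_ordering scale d X \<xi> E"
  shows "eigen_decomp d X \<xi> E"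
proof -
  have inj: "inj_on \<xi> {0..d}" and E: "\<And>i. i \<le> d \<Longrightarrow> E i = prim_idem scale d X \<xi> i"
    and ev: "\<And>i. i \<le> d \<Longrightarrow> \<xi> i \<in> eigenvalues scale X"
    using assms by (auto simp: prim_idem_ordering_def bij_betw_def)
  have "\<exists>x. i \<le> d \<longrightarrow> x \<noteq> 0 \<and> act X x = scaleV (\<xi> i) x" for i
    using eigenvector_exists[OF ev] by metis
  then obtain w where w: "\<And>i. i \<le> d \<Longrightarrow> w i \<noteq> 0 \<and> act X (w i) = scaleV (\<xi> i) (w i)"
    by metis
  have E_w: "act (E h) (w i) = (if h = i then w i else 0)" if "h \<le> d" "i \<le> d" for h i
  proof -
    let ?js = "filter (\<lambda>j. j \<noteq> h) [0..<d + 1]"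
    have "(\<Prod>j\<leftarrow>?js. (\<xi> i - \<xi> j) / (\<xi> h - \<xi> j)) = (if h = i then 1 else 0)"
    proof (cases "h = i")
      case True
      have "(\<xi> i - \<xi> j) / (\<xi> h - \<xi> j) = 1" if "j \<in> set ?js" for j
        using that inj_onD[OF inj, of h j] True \<open>h \<le> d\<close> by (auto simp del: upt_Suc)
      then have "map (\<lambda>j. (\<xi> i - \<xi> j) / (\<xi> h - \<xi> j)) ?js = map (\<lambda>j. 1) ?js"
        by (intro map_cong) auto
      then have "(\<Prod>j\<leftarrow>?js. (\<xi> i - \<xi> j) / (\<xi> h - \<xi> j)) = (\<Prod>j\<leftarrow>?js. 1)"
        by (rule arg_cong)
      also have "\<dots> = 1" by (simp add: map_replicate_const del: upt_Suc)
      finally show ?thesis using True by simp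
    next
      case False
      then have "i \<in> set ?js" using \<open>i \<le> d\<close> by auto
      then have "0 \<in> set (map (\<lambda>j. (\<xi> i - \<xi> j) / (\<xi> h - \<xi> j)) ?js)"
        by (force simp del: upt_Suc)
      then have "(\<Prod>j\<leftarrow>?js. (\<xi> i - \<xi> j) / (\<xi> h - \<xi> j)) = 0"
        by (rule prod_list_zero_iff[THEN iffD2])
      with False show ?thesis by (simp only: if_False)
    qed
    with act_prim_idem_eigenvector[of X "w i" "\<xi> i" \<xi> h] w[of i] that show ?thesis
      by (simp add: E del: upt_Suc)
  qed
  obtain b where b: "V.span (b ` {0..d}) = UNIV" using faithful_spanned by metis
  have card_b: "card (b ` {0..d}) < card {0..Suc d}"
    using card_image_le[of "{0..d}" b] by simp
  have spans: "\<exists>c. x = (\<Sum>i=0..d. scaleV (c i) (w i))" for x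
  proof -
    \<comment> \<open>The vectors \<open>w 0\<close> to \<open>w d\<close> and \<open>x\<close>,
      stored at index \<open>Suc d\<close>, are \<open>d + 2\<close> vectors in a space with at most
      \<open>d + 1\<close> generators.\<close>
    obtain c where c: "(\<Sum>i=0..Suc d. scaleV (c i) ((w(Suc d := x)) i)) = 0"
        "\<exists>i\<in>{0..Suc d}. c i \<noteq> 0"
      using V.nontrivial_relation[OF _ _ card_b, of "w(Suc d := x)"] b by auto
    have "(\<Sum>i=0..d. scaleV (c i) ((w(Suc d := x)) i)) = (\<Sum>i=0..d. scaleV (c i) (w i))"
      by (intro sum.cong) auto
    with c(1) have rel: "(\<Sum>i=0..d. scaleV (c i) (w i)) + scaleV (c (Suc d)) x = 0"
      by simp
    \<comment> \<open>Otherwise applying each \<open>E h\<close> to the relation would make all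
      coefficients zero.\<close>
    have "c (Suc d) \<noteq> 0"
    proof
      assume zero: "c (Suc d) = 0"
      have "c h = 0" if "h \<le> d" for h
      proof -
        have "0 = act (E h) (\<Sum>i=0..d. scaleV (c i) (w i))" using rel zero by simp
        also have "\<dots> = (\<Sum>i=0..d. if i = h then scaleV (c h) (w h) else 0)"
          unfolding act_sum_right by (intro sum.cong) (use that in \<open>auto simp: act_scaleV E_w\<close>)
        finally show ?thesis using that w by simp
      qed
      with zero c(2) show False by (auto simp: le_Suc_eq)
    qed
    have "scaleV (c (Suc d)) x = - (\<Sum>i=0..d. scaleV (c i) (w i))"
      using rel by (simp add: eq_neg_iff_add_eq_0 add.commute)
    then have "scaleV (inverse (c (Suc d))) (scaleV (c (Suc d)) x) =
        scaleV (inverse (c (Suc d))) (- (\<Sum>i=0..d. scaleV (c i) (w i)))" by simp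
    then have "x = (\<Sum>i=0..d. scaleV (- inverse (c (Suc d)) * c i) (w i))"
      using \<open>c (Suc d) \<noteq> 0\<close> by (simp add: V.scale_sum_right sum_negf)
    then show ?thesis by (rule exI[of _ "\<lambda>i. - inverse (c (Suc d)) * c i"])
  qed
  then obtain co where co: "\<And>x. x = (\<Sum>i=0..d. scaleV (co x i) (w i))" by metis
  have E_co: "act (E h) x = scaleV (co x h) (w h)" if "h \<le> d" for h x
  proof -
    have "act (E h) x = (\<Sum>i=0..d. if i = h then scaleV (co x h) (w h) else 0)"
      by (subst co[of x], unfold act_sum_right, intro sum.cong)
        (use that in \<open>auto simp: act_scaleV E_w\<close>)
    with that show ?thesis by simp
  qed
  have "(\<Sum>h=0..d. act (E h) x) = x" for x
    by (subst (2) co[of x]) (simp add: E_co)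
  moreover have "act (E h) (act (E k) x) = (if h = k then act (E h) x else 0)"
    if "h \<le> d" "k \<le> d" for h k x
    using that by (simp add: E_co[of k] act_scaleV E_w)
  moreover have "act (E h) (act X x) = scaleV (\<xi> h) (act (E h) x)" if "h \<le> d" for h x
  proof -
    have "act (E h) (act X x) = (\<Sum>i=0..d. if i = h then scaleV (co x h * \<xi> h) (w h) else 0)"
      by (subst co[of x], unfold act_sum_right, intro sum.cong)
        (use that w in \<open>auto simp: act_scaleV E_w\<close>)
    with that show ?thesis by (simp add: E_co mult.commute)
  qed
  moreover have "\<exists>c. act (E h) x = scaleV c (act (E h) y)" if "h \<le> d" "act (E h) y \<noteq> 0" for h x y
    by (rule exI[of _ "co x h / co y h"]) (use that in \<open>auto simp: E_co\<close>)
  moreover have "\<exists>x. act (E h) x \<noteq> 0" if "h \<le> d" for h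
    using that w E_w by metis
  ultimately show ?thesis using inj unfolding eigen_decomp_def by blast
qed

text \<open>Faithfulness turns a nonzero product into a vector that it does not kill.\<close>

lemma tridiagonalI:
  assumes "\<forall>i\<le>d. \<forall>j\<le>d. (\<bar>int i - int j\<bar> > 1 \<longrightarrow> F i * X * F j = 0) \<and>
    (\<bar>int i - int j\<bar> = 1 \<longrightarrow> F i * X * F j \<noteq> 0)"
  shows "tridiagonal d F X"
proof -
  have *: "act (F i) (act X (act (F j) x)) = act (F i * X * F j) x" for i j x
    by (simp add: act_mult)
  show ?thesis
    unfolding tridiagonal_def * using assms act_faithful by (metis act_zero_left)
qed

end

section \<open>The 24 bases\<close>

locale leonard_module = matrix_module scale d act
  for scale :: "'k::field \<Rightarrow> 'a::ring_1 \<Rightarrow> 'a" and d :: nat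
    and act :: "'a \<Rightarrow> 'v::ab_group_add \<Rightarrow> 'v" +
  fixes A As :: 'a and E Es :: "nat \<Rightarrow> 'a" and \<theta> \<theta>s :: "nat \<Rightarrow> 'k"
    and \<eta>0 \<eta>d \<eta>0s \<eta>ds :: 'v
  assumes leonard: "leonard_system scale d A E As Es"
    and ordering: "prim_idem_ordering scale d A \<theta> E" "prim_idem_ordering scale d As \<theta>s Es"
    and \<eta>_range: "\<eta>0 \<in> range (act (E 0))" "\<eta>d \<in> range (act (E d))"
      "\<eta>0s \<in> range (act (Es 0))" "\<eta>ds \<in> range (act (Es d))"
    and \<eta>_nonzero: "\<eta>0 \<noteq> 0" "\<eta>d \<noteq> 0" "\<eta>0s \<noteq> 0" "\<eta>ds \<noteq> 0"
begin

abbreviation "basis \<equiv> basis_vec scale act d A E \<theta> As Es \<theta>s \<eta>0 \<eta>d \<eta>0s \<eta>ds"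

text \<open>\<open>flag_idem s\<close> orders the eigenspaces so that their partial sums form the flag attached to
  the symbol \<open>s\<close>.\<close>

fun flag_idem :: "symb \<Rightarrow> nat \<Rightarrow> 'a" where
  "flag_idem S0 = E"
| "flag_idem Sd = inversion d E"
| "flag_idem S0' = Es"
| "flag_idem Sd' = inversion d Es"

lemma tridiagonal: "tridiagonal d E As" "tridiagonal d Es A"
  using leonard unfolding leonard_system_def by (auto intro!: tridiagonalI)

lemmas decomp = ordering[THEN prim_idem_ordering_eigen_decomp]

lemma eigen_decomp_flag: "\<exists>X \<xi>. eigen_decomp d X \<xi> (flag_idem s)"
  using decomp decomp[THEN eigen_decomp_reverse] by (cases s) auto

text \<open>Idempotents fix their range. With the reversed orderings each chosen vector belongs to
  index 0, as the adaptedness lemmas require.\<close>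

lemma \<eta>_fixed:
  "act (E 0) \<eta>0 = \<eta>0" "act (inversion d E 0) \<eta>d = \<eta>d"
  "act (Es 0) \<eta>0s = \<eta>0s" "act (inversion d Es 0) \<eta>ds = \<eta>ds"
  using \<eta>_range decomp by (auto simp: eigen_decomp_def inversion_def)

text \<open>In the table, swapping the last two symbols exchanges \<open>i\<close> and
  \<open>d - i\<close>.\<close>

lemma basis_inversion:
  assumes "[w, x, y, z] \<in> S4" "i \<le> d"
  shows "basis [w, x, y, z] i = inversion d (basis [w, x, z, y]) i"
  using assms
  by (cases w; cases x; cases y; cases z; simp add: S4_def; simp add: basis_vec_def inversion_def)

lemma basis_triangular_left:
  assumes "[w, x, y, z] \<in> S4"
  shows "triangular d (flag_idem y) (basis [w, x, y, z])"
proof -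
  \<comment> \<open>Each bundle puts one of the four chosen vectors in the role of
    \<open>\<eta>\<close>. Its first decomposition belongs to the element whose polynomials or
    idempotents are applied, its second to the element having \<open>\<eta>\<close> as an
    eigenvector.\<close>
  note at_0s = decomp tridiagonal(2) \<eta>_fixed(3) \<eta>_nonzero(3)
  note at_ds = decomp(1) eigen_decomp_reverse[OF decomp(2)] tridiagonal_reverse[OF tridiagonal(2)]
    \<eta>_fixed(4) \<eta>_nonzero(4)
  note at_0 = decomp(2,1) tridiagonal(1) \<eta>_fixed(1) \<eta>_nonzero(1)
  note at_d = decomp(2) eigen_decomp_reverse[OF decomp(1)] tridiagonal_reverse[OF tridiagonal(1)]
    \<eta>_fixed(2) \<eta>_nonzero(2)
  note taus = triangular_tau[OF at_0s] triangular_tau[OF at_ds]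
    triangular_tau[OF at_0] triangular_tau[OF at_d]
    triangular_tau_reverse[OF at_0s] triangular_tau_reverse[OF at_ds]
    triangular_tau_reverse[OF at_0] triangular_tau_reverse[OF at_d]
  note sigmas = triangular_sigma[OF at_0s] triangular_sigma[OF at_ds]
    triangular_sigma[OF at_0] triangular_sigma[OF at_d]
  note idems = triangular_idem[OF at_0s] triangular_idem[OF at_ds]
    triangular_idem[OF at_0] triangular_idem[OF at_d]
  show ?thesis
    using assms
    by (cases w; cases x; cases y; cases z; simp add: S4_def;
      simp add: basis_vec_def[abs_def] taus sigmas idems)
qed

text \<open>Inverting the basis swaps the last two symbols, so \<open>z\<close> takes the third
  place.\<close>

lemma basis_triangular_right:
  assumes "[w, x, y, z] \<in> S4"
  shows "triangular d (flag_idem z) (inversion d (basis [w, x, y, z]))"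
proof -
  have S4: "[w, x, z, y] \<in> S4" using assms by (auto simp: S4_def)
  have "triangular d (flag_idem z) (basis [w, x, z, y]) \<longleftrightarrow>
      triangular d (flag_idem z) (inversion d (basis [w, x, y, z]))"
    by (rule triangular_cong) (simp_all add: basis_inversion[OF S4])
  with basis_triangular_left[OF S4] show ?thesis by simp
qed

section \<open>Transition matrices between the 24 bases\<close>

abbreviation "trans_mat g h \<equiv> transition_matrix scaleV d (basis g) (basis h)"

lemma trans_mat_dims:
  assumes "[w, x, y, z] \<in> S4"
  shows "trans_mat [w, x, y, z] h \<in> carrier_mat (d + 1) (d + 1)"
  using eigen_decomp_flag transition_matrix_props(1) basis_triangular_left[OF assms] by metis

text \<open>A common third symbol is a common flag for both bases read forwards.\<close>

lemma trans_mat_upper: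
  assumes "[w, x, y, z] \<in> S4" "[w', x', y, z'] \<in> S4" "j < i" "i \<le> d"
  shows "trans_mat [w, x, y, z] [w', x', y, z'] $$ (i, j) = 0"
  using eigen_decomp_flag[of y] transition_matrix_upper assms basis_triangular_left by metis

text \<open>A common last symbol is a common flag for both bases read backwards.\<close>

lemma trans_mat_lower:
  assumes "[w, x, y, z] \<in> S4" "[w', x', y', z] \<in> S4" "i < j" "j \<le> d"
  shows "trans_mat [w, x, y, z] [w', x', y', z] $$ (i, j) = 0"
  using eigen_decomp_flag[of y] transition_matrix_lower assms basis_triangular_left
    basis_triangular_right by metis

lemma trans_mat_adjacent1:
  assumes "adjacent1 g h"
  shows "diagonal_mat (trans_mat g h)"
proof -
  obtain w x y z where gh: "g = [w, x, y, z]" "h = [x, w, y, z]" and S4: "[w, x, y, z] \<in> S4"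
    using assms unfolding adjacent1_def by auto
  then have S4': "[x, w, y, z] \<in> S4" by (auto simp: S4_def)
  have "trans_mat g h $$ (i, j) = 0" if "i \<noteq> j" "i \<le> d" "j \<le> d" for i j
    using trans_mat_upper[OF S4 S4', of j i] trans_mat_lower[OF S4 S4', of i j] that
    unfolding gh by linarith
  then show ?thesis
    using trans_mat_dims[OF S4, of h] unfolding gh diagonal_mat_def by auto
qed

lemma trans_mat_adjacent2:
  assumes "adjacent2 g h"
  shows "lower_triangular (trans_mat g h)"
proof -
  obtain w x y z where gh: "g = [w, x, y, z]" "h = [w, y, x, z]" and S4: "[w, x, y, z] \<in> S4"
    using assms unfolding adjacent2_def by auto
  then have S4': "[w, y, x, z] \<in> S4" by (auto simp: S4_def)
  show ?thesis
    using trans_mat_dims[OF S4, of h] trans_mat_lower[OF S4 S4']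
    unfolding gh lower_triangular_def by auto
qed

end

theorem lemma9p4:
  fixes scale :: "'k::field \<Rightarrow> 'a::ring_1 \<Rightarrow> 'a"
    and act :: "'a \<Rightarrow> 'v::ab_group_add \<Rightarrow> 'v"
    and d :: nat
    and A As :: 'a and E Es :: "nat \<Rightarrow> 'a"
    and \<theta> \<theta>s :: "nat \<Rightarrow> 'k"
    and \<eta>0 \<eta>d \<eta>0s \<eta>ds :: 'v
    and g h :: "symb list"
  defines "basis \<equiv> basis_vec scale act d A E \<theta> As Es \<theta>s \<eta>0 \<eta>d \<eta>0s \<eta>ds"
    and "trans_mat \<equiv> transition_matrix (module_scale scale act) d"
  assumes "full_matrix_algebra scale d"
    and "irreducible_left_module act"
    and "leonard_system scale d A E As Es"
    and "prim_idem_ordering scale d A \<theta> E"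
    and "prim_idem_ordering scale d As \<theta>s Es"
    and "\<eta>0 \<in> range (act (E 0))" and "\<eta>0 \<noteq> 0"
    and "\<eta>d \<in> range (act (E d))" and "\<eta>d \<noteq> 0"
    and "\<eta>0s \<in> range (act (Es 0))" and "\<eta>0s \<noteq> 0"
    and "\<eta>ds \<in> range (act (Es d))" and "\<eta>ds \<noteq> 0"
    and "g \<in> S4" and "h \<in> S4" and "adjacent g h"
  shows "(adjacent1 g h \<longrightarrow> diagonal_mat (trans_mat (basis g) (basis h))) \<and>
         (adjacent2 g h \<longrightarrow> lower_triangular (trans_mat (basis g) (basis h))) \<and>
         (adjacent3 g h \<longrightarrow> (\<forall>i\<le>d. basis g i = inversion d (basis h) i))"
proof -
  interpret full_matrix_algebra scale d by fact
  interpret irreducible_left_module act by fact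
  interpret leonard_module scale d act A As E Es \<theta> \<theta>s \<eta>0 \<eta>d \<eta>0s \<eta>ds
    by unfold_locales fact+
  have "basis g i = inversion d (basis h) i" if "adjacent3 g h" "i \<le> d" for i
    using that basis_inversion unfolding adjacent3_def basis_def by blast
  then show ?thesis
    using trans_mat_adjacent1 trans_mat_adjacent2 unfolding basis_def trans_mat_def by blast
qed

end
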